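(* Let $\mathbf{n}=(n_1,\ldots,n_d)\in\mathbb{N}^d$ have pairwise relatively prime entries. For $\mathfrak{r}\in\{0,1\}$ we have $$\mathrm{LC}^{(\mathbf{n})}_{\mathfrak{r}}=\bigl\{\ell^{(\mathbf{n})}_{\mathbf{0},\mathbf{1}}(t^{(\mathbf{n})}_l)\ \big|\ l\in\{0,\ldots,p[\mathbf{n}]\}\ \text{with}\ l\equiv\mathfrak{r}\bmod 2\bigr\}.$$ In particular, $\mathrm{LC}^{(\mathbf{n})}=\mathrm{LD}^{(\mathbf{n})}_{\mathbf{1}}$.
   Context: $\mathbb{N}=\{1,2,\ldots\}$, $\mathbb{N}_0=\mathbb{N}\cup\{0\}$, $d\in\mathbb{N}$. Set $p[\mathbf{n}]=\prod_{j=1}^d n_j$, $p_i[\mathbf{n}]=\prod_{j\neq i}n_j$, $t^{(\mathbf{n})}_l=l\pi/p[\mathbf{n}]$. For $\mathfrak{r}\in\{0,1\}$ let $I^{(\mathbf{n})}_{\mathfrak{r}}$ be the set of all $\mathbf{i}\in\mathbb{N}_0^d$ with $0\le i_j\le n_j$ and $i_j\equiv\mathfrak{r}\bmod 2$ for all $j\in\{1,\ldots,d\}$. Let $\mathbf{z}^{(\mathbf{n})}_{\mathbf{i}}=(\cos(i_1\pi/n_1),\ldots,\cos(i_d\pi/n_d))$, $\mathrm{LC}^{(\mathbf{n})}_{\mathfrak{r}}=\{\mathbf{z}^{(\mathbf{n})}_{\mathbf{i}}\mid\mathbf{i}\in I^{(\mathbf{n})}_{\mathfrak{r}}\}$ and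 $\mathrm{LC}^{(\mathbf{n})}=\mathrm{LC}^{(\mathbf{n})}_0\cup\mathrm{LC}^{(\mathbf{n})}_1$. The curve is $\ell^{(\mathbf{n})}_{\mathbf{0},\mathbf{1}}(t)=(\cos(p_1[\mathbf{n}]t),\ldots,\cos(p_d[\mathbf{n}]t))$, and $\mathrm{LD}^{(\mathbf{n})}_{\mathbf{1}}=\{\ell^{(\mathbf{n})}_{\mathbf{0},\mathbf{1}}(t^{(\mathbf{n})}_l)\mid l\in\{0,\ldots,p[\mathbf{n}]\}\}$. *)

theory Defs
  imports "HOL-Analysis.Analysis" "HOL-Number_Theory.Cong"
begin

text \<open>The dimension is the cardinality of the finite index type \<open>'d\<close> (which is nonempty);
  the coordinates of a vector are indexed by \<open>'d\<close>.\<close>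

definition p_all :: "nat ^ 'd \<Rightarrow> nat" where
  "p_all n = (\<Prod>j\<in>UNIV. n $ j)"

definition p_except :: "'d \<Rightarrow> nat ^ 'd \<Rightarrow> nat" where
  "p_except i n = (\<Prod>j\<in>UNIV - {i}. n $ j)"

definition t_node :: "nat ^ 'd \<Rightarrow> nat \<Rightarrow> real" where
  "t_node n l = real l * pi / real (p_all n)"

definition I_set :: "nat ^ 'd \<Rightarrow> nat \<Rightarrow> (nat ^ 'd) set" where
  "I_set n r = {i. \<forall>j. i $ j \<le> n $ j \<and> [i $ j = r] (mod 2)}"

definition z_point :: "nat ^ 'd \<Rightarrow> nat ^ 'd \<Rightarrow> real ^ 'd" where
  "z_point n i = (\<chi> j. cos (real (i $ j) * pi / real (n $ j)))"

definition LC_part :: "nat ^ 'd \<Rightarrow> nat \<Rightarrow> (real ^ 'd) set" where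
  "LC_part n r = {z_point n i | i. i \<in> I_set n r}"

definition LC :: "nat ^ 'd \<Rightarrow> (real ^ 'd) set" where
  "LC n = LC_part n 0 \<union> LC_part n 1"

text \<open>The curve \<open>\<ell>\<^sub>0\<^sub>,\<^sub>1\<close>: all phase shifts are zero and all reflection signs are one.\<close>

definition lissajous :: "nat ^ 'd \<Rightarrow> real \<Rightarrow> real ^ 'd" where
  "lissajous n t = (\<chi> j. cos (real (p_except j n) * t))"

definition LD :: "nat ^ 'd \<Rightarrow> (real ^ 'd) set" where
  "LD n = {lissajous n (t_node n l) | l. l \<in> {0..p_all n}}"

end

theory Submission
  imports Defs
begin

text \<open>At the nodes the curve has coordinates \<open>cos (l * pi / n\<^sub>j)\<close>, which depend on \<open>l\<close> only up to
  sign and modulo \<open>2 * n\<^sub>j\<close>. Folding \<open>l\<close> into \<open>{0..n\<^sub>j}\<close> preserves its parity and shows that nodes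
  of the curve are Chebyshev points. Conversely, writing \<open>i\<^sub>j = r + 2 * a\<^sub>j\<close>, the Chinese remainder
  theorem yields \<open>x \<equiv> a\<^sub>j (mod n\<^sub>j)\<close> for all \<open>j\<close>; then \<open>l = r + 2 * x \<equiv> i\<^sub>j (mod 2 * n\<^sub>j)\<close> has the
  right parity even if some \<open>n\<^sub>j\<close> is even, and it can be folded into \<open>{0..\<Prod>\<^sub>j n\<^sub>j}\<close>.\<close>

lemma cos_pi_frac_cong:
  fixes k l q :: nat
  assumes "[k = l] (mod 2 * q)"
  shows "cos (real k * pi / real q) = cos (real l * pi / real q)"
\<comment> \<open>For \<open>q = 0\<close> both quotients are \<open>0\<close> by the convention on
  division, so \<open>simp\<close> closes that case at the end.\<close>
proof (cases "q = 0")
  case False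
  have *: "cos (real (x + 2 * q * t) * pi / real q) = cos (real x * pi / real q)" for x t :: nat
  proof -
    have "real (x + 2 * q * t) * pi / real q = real x * pi / real q + 2 * pi * real t"
      using False by (simp add: add_divide_distrib distrib_right)
    then show ?thesis
      using cos.plus_of_nat[of "real x * pi / real q" t] by (simp add: mult.commute)
  qed
  have **: "cos (real x * pi / real q) = cos (real (x mod (2 * q)) * pi / real q)" for x
    using *[of "x mod (2 * q)" "x div (2 * q)"] by simp
  show ?thesis
    unfolding **[of k] **[of l] using assms by (simp only: cong_def)
qed simp

text \<open>Since \<open>q\<close> divides \<open>m\<close>, the angle \<open>2 * m * pi / q\<close>
  is a multiple of \<open>2 * pi\<close>, and cosine is even.\<close>

lemma cos_pi_frac_reflect:
  fixes k m q :: nat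
  assumes "q dvd m" "k \<le> 2 * m"
  shows "cos (real (2 * m - k) * pi / real q) = cos (real k * pi / real q)"
proof (cases "q = 0")
  case False
  obtain t where m: "m = q * t" using assms(1) by blast
  have "real (2 * m - k) * pi / real q = - (real k * pi / real q) + 2 * pi * real t"
    using False assms(2) by (simp add: m of_nat_diff diff_divide_distrib left_diff_distrib)
  then show ?thesis
    using cos.plus_of_nat[of "- (real k * pi / real q)" t] by (simp add: mult.commute)
qed simp

text \<open>Reduction modulo \<open>2 * m\<close>, followed by reflection if the remainder exceeds
  \<open>m\<close>, keeps the parity because \<open>2 * m\<close> is even. The same \<open>k\<close>
  serves all divisors \<open>q\<close> of \<open>m\<close> at once.\<close>

lemma cos_pi_frac_fold:
  fixes l m :: nat
  assumes "m > 0"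
  obtains k where "k \<le> m" "[k = l] (mod 2)"
    and "\<And>q. q dvd m \<Longrightarrow> cos (real k * pi / real q) = cos (real l * pi / real q)"
proof -
  define h where "h = l mod (2 * m)"
  have h: "h < 2 * m" "[h = l] (mod 2 * m)"
    using assms by (simp_all add: h_def)
  have par: "[h = l] (mod 2)"
    using h(2) by (rule cong_dvd_modulus_nat) simp
  have cos_h: "cos (real h * pi / real q) = cos (real l * pi / real q)" if "q dvd m" for q
  proof (rule cos_pi_frac_cong)
    show "[h = l] (mod 2 * q)"
      using h(2) by (rule cong_dvd_modulus_nat) (use that in simp)
  qed
  show ?thesis
  proof (cases "h \<le> m")
    case True
    then show ?thesis
      using par cos_h by (rule that)
  next
    case False
    show ?thesis
    proof (rule that)
      show "2 * m - h \<le> m"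
        using False by simp
      show "[2 * m - h = l] (mod 2)"
        using par h(1) by (auto simp: cong_def mod2_eq_if even_diff_nat split: if_splits)
      show "cos (real (2 * m - h) * pi / real q) = cos (real l * pi / real q)" if "q dvd m" for q
        using cos_pi_frac_reflect[OF that less_imp_le[OF h(1)]] cos_h[OF that] by (rule trans)
    qed
  qed
qed

lemma p_all_eq: "p_all n = n $ j * p_except j n"
  unfolding p_all_def p_except_def by (simp add: prod.remove)

lemma lissajous_t_node_nth:
  assumes "p_all n > 0"
  shows "lissajous n (t_node n l) $ j = cos (real l * pi / real (n $ j))"
  using assms by (simp add: lissajous_def t_node_def p_all_eq[of n j] field_simps)

text \<open>Each coordinate is folded separately, with \<open>m = q = n $ j\<close>; all the results
  inherit the parity of the one index \<open>l\<close>.\<close>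

lemma lissajous_node_in_LC_part:
  assumes "p_all n > 0" "[l = r] (mod 2)"
  shows "lissajous n (t_node n l) \<in> LC_part n r"
proof -
  have "\<exists>k \<le> n $ j. [k = l] (mod 2) \<and>
      cos (real k * pi / real (n $ j)) = cos (real l * pi / real (n $ j))" for j
  proof -
    have "n $ j > 0"
      using assms(1) by (simp add: p_all_eq[of n j])
    then show ?thesis
      by (rule cos_pi_frac_fold[of _ l]) auto
  qed
  then obtain f where f: "\<And>j. f j \<le> n $ j" "\<And>j. [f j = l] (mod 2)"
    "\<And>j. cos (real (f j) * pi / real (n $ j)) = cos (real l * pi / real (n $ j))"
    by metis
  have "(\<chi> j. f j) \<in> I_set n r"
    using f(1,2) assms(2) by (simp add: I_set_def cong_def)
  moreover have "lissajous n (t_node n l) = z_point n (\<chi> j. f j)"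
    by (simp add: vec_eq_iff lissajous_t_node_nth[OF assms(1)] z_point_def f(3))
  ultimately show ?thesis
    unfolding LC_part_def by blast
qed

lemma z_point_eq_lissajous_node:
  fixes n :: "nat ^ 'd"
  assumes pos: "p_all n > 0"
    and cop: "\<forall>i j. i \<noteq> j \<longrightarrow> coprime (n $ i) (n $ j)"
    and r: "r \<in> {0, 1}" and i: "i \<in> I_set n r"
  obtains l where "l \<le> p_all n" "[l = r] (mod 2)" "z_point n i = lissajous n (t_node n l)"
proof -
  \<comment> \<open>The moduli \<open>2 * n $ j\<close> have the common factor \<open>2\<close>, so
    the halves are matched modulo the coprime \<open>n $ j\<close> instead.\<close>
  obtain x where x: "\<And>j. [x = i $ j div 2] (mod n $ j)"
    using chinese_remainder_nat[of "UNIV :: 'd set" "\<lambda>j. n $ j" "\<lambda>j. i $ j div 2"] cop by auto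
  have i_mod: "i $ j mod 2 = r" for j
    using i r by (auto simp: I_set_def cong_def)
  have cong: "[r + 2 * x = i $ j] (mod 2 * n $ j)" for j
  proof -
    have "[r + 2 * x = r + 2 * (i $ j div 2)] (mod 2 * n $ j)"
      \<comment> \<open>After \<open>r\<close> is cancelled, the factor \<open>2\<close> is pulled
        out of both sides together with the modulus.\<close>
      using x[of j] by (simp add: cong_add_lcancel_nat) (simp add: cong_def flip: mult_mod_right)
    also have "r + 2 * (i $ j div 2) = i $ j"
      using mod_mult_div_eq[of "i $ j" 2] by (simp add: i_mod)
    finally show ?thesis .
  qed
  \<comment> \<open>Folding at \<open>p_all n\<close>, a multiple of every \<open>n $ j\<close>,
    keeps one index valid for all coordinates.\<close>
  obtain l where l: "l \<le> p_all n" "[l = r + 2 * x] (mod 2)"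
    "\<And>q. q dvd p_all n \<Longrightarrow> cos (real l * pi / real q) = cos (real (r + 2 * x) * pi / real q)"
    using cos_pi_frac_fold[OF pos] by blast
  have "cos (real (i $ j) * pi / real (n $ j)) = cos (real l * pi / real (n $ j))" for j
    using l(3)[of "n $ j"] cos_pi_frac_cong[OF cong[of j]] by (simp add: p_all_eq[of n j])
  then have "z_point n i = lissajous n (t_node n l)"
    by (simp add: vec_eq_iff lissajous_t_node_nth[OF pos] z_point_def)
  moreover have "[l = r] (mod 2)"
    using l(2) by (simp add: cong_def)
  ultimately show ?thesis
    using l(1) that by blast
qed

theorem theorem2p2:
  fixes n :: "nat ^ 'd"
  assumes "\<forall>j. n $ j \<ge> 1"
    and "\<forall>i j. i \<noteq> j \<longrightarrow> coprime (n $ i) (n $ j)"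
  shows "(\<forall>r\<in>{0, 1}. LC_part n r =
            {lissajous n (t_node n l) | l. l \<in> {0..p_all n} \<and> [l = r] (mod 2)})
         \<and> LC n = LD n"
proof -
  have pos: "p_all n > 0"
    using assms(1) unfolding p_all_def by (intro prod_pos) (simp add: Suc_le_eq)
  have part: "LC_part n r =
      {lissajous n (t_node n l) | l. l \<in> {0..p_all n} \<and> [l = r] (mod 2)}" (is "_ = ?R")
    if r: "r \<in> {0, 1}" for r
  proof
    show "LC_part n r \<subseteq> ?R"
    proof
      fix z assume "z \<in> LC_part n r"
      then obtain i where i: "i \<in> I_set n r" and z: "z = z_point n i"
        unfolding LC_part_def by blast
      obtain l where "l \<le> p_all n" "[l = r] (mod 2)" "z_point n i = lissajous n (t_node n l)"
        using pos assms(2) r i by (rule z_point_eq_lissajous_node)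
      then show "z \<in> ?R"
        using z by auto
    qed
    show "?R \<subseteq> LC_part n r"
      using lissajous_node_in_LC_part[OF pos] by blast
  qed
  \<comment> \<open>This splits the nodes in \<open>LD n\<close> between the two parts of
    \<open>LC n\<close>.\<close>
  have parity: "[l = 0] (mod 2) \<or> [l = 1] (mod 2)" for l :: nat
    unfolding cong_def by presburger
  have "LC n = LD n"
  proof
    show "LC n \<subseteq> LD n"
      using part[of 0] part[of 1] by (auto simp: LC_def LD_def)
    show "LD n \<subseteq> LC n"
      using parity lissajous_node_in_LC_part[OF pos] by (auto simp: LC_def LD_def)
  qed
  with part show ?thesis by simp
qed

end
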